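(* Let $q$ be a prime power and let $\mathcal{M}$ denote the class of $q$-matroids over $\mathbb{F}_q$. The rank generating polynomial $\rho:\mathcal{M}\to\mathbb{Z}[x,y]$, $M\mapsto\rho(M;x,y)$, is not a $q$-Tutte–Grothendieck invariant.
   Context: A $q$-matroid is a pair $M=(\mathcal{L},r)$, where $\mathcal{L}$ is the lattice of all subspaces of a finite-dimensional vector space over $\mathbb{F}_q$, ordered by inclusion with meet $\wedge$ (intersection) and join $\vee$ (sum). $\mathrm{h}(x)$ is the dimension of $x$; $\mathbf{0},\mathbf{1}$ are the least and greatest elements; $n=\mathrm{h}(\mathbf{1})$. The function $r:\mathcal{L}\to\mathbb{Z}_{\ge 0}$ satisfies: $0\le r(x)\le \mathrm{h}(x)$; $x\le y\Rightarrow r(x)\le r(y)$; $r(x\vee y)+r(x\wedge y)\le r(x)+r(y)$. The nullity is $\nu(x)=\mathrm{h}(x)-r(x)$. The minor $M([a,b])$ is $([a,b],r_{[a,b]})$ with $r_{[a,b]}(x)=r(x)-r(a)$ (regarded as a $q$-matroid via the isomorphism of $[a,b]$ with the subspace lattice of $b/a$); $M(a):=M([\mathbf{0},a])$ and $M/a:=M([a,\mathbf{1}])$. $M_1=(\mathcal{L}_1,r_1)\cong M_2=(\mathcal{L}_2,r_2)$ means there is a lattice isomorphism $\varphi:\mathcal{L}_1\to\mathcal{L}_2$ with $r_1(x)=r_2(\varphi(x))$ for all $x$. The rank generating polynomial is $\rho(M;x,y)=\sum_{z\in\mathcal{L}}x^{r(\mathbf{1})-r(z)}y^{\nu(z)}$.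 Atoms are elements of height $1$; coatoms have height $n-1$. An element $x$ is independent if $r(x)=\mathrm{h}(x)$. A coloop is a coatom $x$ with $r(x)=r(\mathbf{1})-1$. A diamond is an interval $[a,b]$ with $\mathrm{h}(b)-\mathrm{h}(a)=2$; it is prime if $r(x)-r(a)=1$ and $r(b)-r(x)=0$ for every $a<x<b$. $M$ is prime-free if $\mathcal{L}$ contains no prime diamond. A proper interval decomposition $\mathcal{P}(e)$ of $\mathcal{L}$ is a partition of $\mathcal{L}$ into disjoint intervals of the form $[e,\mathbf{1}]\,\dot\cup\,[\mathbf{0},e^c]\,\dot\cup\,[e_1,\bar e_1]\,\dot\cup\cdots\dot\cup\,[e_{q^{n-1}-1},\bar e_{q^{n-1}-1}]$, where $e$ is an atom, $e^c$ is a complement of $e$ (i.e. $e\wedge e^c=\mathbf{0}$, $e\vee e^c=\mathbf{1}$), and each $e_k$ is an atom, $\bar e_k$ a coatom, $e_k\le \bar e_k$. A function $f$ on $\mathcal{M}$ is a $q$-Tutte–Grothendieck invariant if: ($q$-P1) $M_1\cong M_2$ implies $f(M_1)=f(M_2)$; ($q$-P2) if $M$ is prime-free, then $f(M)=f(M(e))f(M/e)$ for any atom $e\in\mathcal{L}$; ($q$-P3) if $M$ is not prime-free, and $e$ is an atom that is independent and contained in every coloop of $M$, then there exists a proper interval decomposition $\mathcal{P}(e)$ such that $f(M)=\sum_{I\in\mathcal{P}(e)}f(M(I))=f(M(e^c))+f(M/e)+\sum_{k=1}^{q^{n-1}-1}f(M([e_k,\bar e_k]))$. *)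

theory Defs
  imports
    "HOL-Library.Function_Algebras"
    "HOL-Library.Cardinality"
    "HOL-Library.Disjoint_Sets"
    "HOL-Computational_Algebra.Polynomial"
begin

text \<open>
  The field \<open>\<bbbF>\<^sub>q\<close> is a type \<open>'k\<close> of sorts \<open>field\<close> and \<open>finite\<close>, with \<open>q = CARD('k)\<close>.
  The finite-dimensional vector spaces over it are taken as the finite-dimensional
  subspaces of the infinite-dimensional space \<open>nat \<Rightarrow> 'k\<close> with pointwise operations.
  Up to isomorphism these are all of them, in every dimension, so that a single type carries
  the whole class of \<open>q\<close>-matroids over \<open>\<bbbF>\<^sub>q\<close>.
\<close>

type_synonym 'k vect = "nat \<Rightarrow> 'k"

definition vscale :: "'k::field \<Rightarrow> 'k vect \<Rightarrow> 'k vect" where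
  "vscale c v = (\<lambda>i. c * v i)"

global_interpretation vs: vector_space "vscale :: 'k::field \<Rightarrow> 'k vect \<Rightarrow> 'k vect"
  by unfold_locales (auto simp: vscale_def fun_eq_iff algebra_simps)

abbreviation height :: "'k::field vect set \<Rightarrow> nat" where
  "height x \<equiv> vs.dim x"

definition join :: "'k::field vect set \<Rightarrow> 'k vect set \<Rightarrow> 'k vect set" where
  "join x y = vs.span (x \<union> y)"

abbreviation zero_space :: "'k::field vect set" where
  "zero_space \<equiv> {0}"


text \<open>
  A \<open>q\<close>-matroid is stored as the ambient space \<open>\<one>\<close> together with the rank function. Only the
  values of the rank function on the subspaces of \<open>\<one>\<close> are meaningful.
\<close>

record 'k qmatroid =
  top_space :: "'k vect set"
  rank :: "'k vect set \<Rightarrow> nat"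

definition subspaces :: "'k::field qmatroid \<Rightarrow> 'k vect set set" where
  "subspaces M = {x. vs.subspace x \<and> x \<subseteq> top_space M}"

definition is_qmatroid :: "'k::field qmatroid \<Rightarrow> bool" where
  "is_qmatroid M \<longleftrightarrow>
     (\<exists>B. finite B \<and> top_space M = vs.span B) \<and>
     (\<forall>x\<in>subspaces M. rank M x \<le> height x) \<and>
     (\<forall>x\<in>subspaces M. \<forall>y\<in>subspaces M. x \<subseteq> y \<longrightarrow> rank M x \<le> rank M y) \<and>
     (\<forall>x\<in>subspaces M. \<forall>y\<in>subspaces M.
        rank M (join x y) + rank M (x \<inter> y) \<le> rank M x + rank M y)"

definition nullity :: "'k::field qmatroid \<Rightarrow> 'k vect set \<Rightarrow> nat" where
  "nullity M x = height x - rank M x"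

definition isomorphic :: "'k::field qmatroid \<Rightarrow> 'k qmatroid \<Rightarrow> bool" where
  "isomorphic M N \<longleftrightarrow> (\<exists>\<phi>. bij_betw \<phi> (subspaces M) (subspaces N) \<and>
     (\<forall>x\<in>subspaces M. \<forall>y\<in>subspaces M.
        \<phi> (x \<inter> y) = \<phi> x \<inter> \<phi> y \<and> \<phi> (join x y) = join (\<phi> x) (\<phi> y)) \<and>
     (\<forall>x\<in>subspaces M. rank M x = rank N (\<phi> x)))"

definition interval :: "'k::field qmatroid \<Rightarrow> 'k vect set \<Rightarrow> 'k vect set \<Rightarrow> 'k vect set set" where
  "interval M a b = {x \<in> subspaces M. a \<subseteq> x \<and> x \<subseteq> b}"


text \<open>
  The quotient \<open>b/a\<close> is realised inside the same universe by a linear complement \<open>c\<close> of \<open>a\<close>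
  in \<open>b\<close>. The composite \<open>c \<rightarrow> b \<rightarrow> b/a\<close> is a linear isomorphism, under which a subspace \<open>z\<close>
  of \<open>c\<close> corresponds to the element \<open>a \<or> z\<close> of \<open>[a, b]\<close>. The lemmas \<open>is_qmatroid_minor\<close> and
  \<open>minor_interval_iso\<close> below confirm that this is \<open>([a, b], r\<^bsub>[a,b]\<^esub>)\<close> up to lattice
  isomorphism. If \<open>a\<close> is zero, then \<open>c = b\<close> and the minor is the restriction to \<open>b\<close>.
\<close>

definition quotient_space :: "'k::field vect set \<Rightarrow> 'k vect set \<Rightarrow> 'k vect set" where
  "quotient_space b a =
     (SOME c. vs.subspace c \<and> c \<subseteq> b \<and> a \<inter> c = zero_space \<and> join a c = b)"

definition minor :: "'k::field qmatroid \<Rightarrow> 'k vect set \<Rightarrow> 'k vect set \<Rightarrow> 'k qmatroid" where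
  "minor M a b = \<lparr>top_space = quotient_space b a, rank = (\<lambda>z. rank M (join a z) - rank M a)\<rparr>"

abbreviation restriction :: "'k::field qmatroid \<Rightarrow> 'k vect set \<Rightarrow> 'k qmatroid" where
  "restriction M a \<equiv> minor M zero_space a"

abbreviation contraction :: "'k::field qmatroid \<Rightarrow> 'k vect set \<Rightarrow> 'k qmatroid" where
  "contraction M a \<equiv> minor M a (top_space M)"


definition atom :: "'k::field qmatroid \<Rightarrow> 'k vect set \<Rightarrow> bool" where
  "atom M e \<longleftrightarrow> e \<in> subspaces M \<and> height e = 1"

definition coatom :: "'k::field qmatroid \<Rightarrow> 'k vect set \<Rightarrow> bool" where
  "coatom M x \<longleftrightarrow> x \<in> subspaces M \<and> height x + 1 = height (top_space M)"

definition independent :: "'k::field qmatroid \<Rightarrow> 'k vect set \<Rightarrow> bool" where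
  "independent M x \<longleftrightarrow> x \<in> subspaces M \<and> rank M x = height x"

definition coloop :: "'k::field qmatroid \<Rightarrow> 'k vect set \<Rightarrow> bool" where
  "coloop M x \<longleftrightarrow> coatom M x \<and> rank M x + 1 = rank M (top_space M)"

definition diamond :: "'k::field qmatroid \<Rightarrow> 'k vect set \<Rightarrow> 'k vect set \<Rightarrow> bool" where
  "diamond M a b \<longleftrightarrow>
     a \<in> subspaces M \<and> b \<in> subspaces M \<and> a \<subseteq> b \<and> height b = height a + 2"

definition prime_diamond :: "'k::field qmatroid \<Rightarrow> 'k vect set \<Rightarrow> 'k vect set \<Rightarrow> bool" where
  "prime_diamond M a b \<longleftrightarrow> diamond M a b \<and>
     (\<forall>x\<in>subspaces M. a \<subset> x \<and> x \<subset> b \<longrightarrow> rank M x = rank M a + 1 \<and> rank M b = rank M x)"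

definition prime_free :: "'k::field qmatroid \<Rightarrow> bool" where
  "prime_free M \<longleftrightarrow> \<not> (\<exists>a b. prime_diamond M a b)"

definition is_complement ::
    "'k::field qmatroid \<Rightarrow> 'k vect set \<Rightarrow> 'k vect set \<Rightarrow> bool" where
  "is_complement M e c \<longleftrightarrow> c \<in> subspaces M \<and> e \<inter> c = zero_space \<and> join e c = top_space M"


text \<open>
  An interval is represented by the pair of its endpoints. The set \<open>K\<close> holds the intervals
  other than \<open>[e, \<one>]\<close> and \<open>[\<zero>, e\<^sup>c]\<close>.
\<close>

definition proper_interval_decomposition ::
    "'k::{field,finite} qmatroid \<Rightarrow> 'k vect set \<Rightarrow> ('k vect set \<times> 'k vect set) set \<Rightarrow> bool" where
  "proper_interval_decomposition M e P \<longleftrightarrow> atom M e \<and>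
     (\<exists>c K. is_complement M e c \<and>
        P = {(e, top_space M), (zero_space, c)} \<union> K \<and>
        finite K \<and> card K = CARD('k) ^ (height (top_space M) - 1) - 1 \<and>
        (\<forall>(a, b)\<in>K. atom M a \<and> coatom M b \<and> a \<subseteq> b) \<and>
        partition_on (subspaces M) ((\<lambda>(a, b). interval M a b) ` P))"

definition q_Tutte_Grothendieck_invariant ::
    "('k::{field,finite} qmatroid \<Rightarrow> 'r::comm_ring_1) \<Rightarrow> bool" where
  "q_Tutte_Grothendieck_invariant f \<longleftrightarrow>
     (\<forall>M N. is_qmatroid M \<and> is_qmatroid N \<and> isomorphic M N \<longrightarrow> f M = f N) \<and>
     (\<forall>M. is_qmatroid M \<and> prime_free M \<longrightarrow>
        (\<forall>e. atom M e \<longrightarrow> f M = f (restriction M e) * f (contraction M e))) \<and>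
     (\<forall>M. is_qmatroid M \<and> \<not> prime_free M \<longrightarrow>
        (\<forall>e. atom M e \<and> independent M e \<and> (\<forall>x. coloop M x \<longrightarrow> e \<subseteq> x) \<longrightarrow>
           (\<exists>P. proper_interval_decomposition M e P \<and>
                f M = (\<Sum>(a, b)\<in>P. f (minor M a b)))))"


text \<open>
  The ring \<open>\<int>[x, y]\<close> is \<open>\<int>[x][y]\<close>, so \<open>monom (monom 1 i) j\<close> is \<open>x\<^sup>i y\<^sup>j\<close>.
\<close>

definition rank_generating_polynomial :: "'k::{field,finite} qmatroid \<Rightarrow> int poly poly" where
  "rank_generating_polynomial M =
     (\<Sum>z\<in>subspaces M. monom (monom 1 (rank M (top_space M) - rank M z)) (nullity M z))"


lemma join_alt:
  assumes "vs.subspace a" "vs.subspace b"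
  shows "join a b = {u + v | u v. u \<in> a \<and> v \<in> b}"
proof -
  have "vs.span a = a" "vs.span b = b"
    using assms by (metis vs.span_eq_iff)+
  then show ?thesis
    unfolding join_def vs.span_Un by metis
qed

lemma join_least:
  assumes "vs.subspace c" "a \<subseteq> c" "b \<subseteq> c"
  shows "join a b \<subseteq> c"
  using assms unfolding join_def by (simp add: vs.span_minimal)

lemma join_upper1: "a \<subseteq> join a b" and join_upper2: "b \<subseteq> join a b" for a b
  using vs.span_superset[of "a \<union> b"] unfolding join_def by auto

lemma subspace_join: "vs.subspace (join a b)"
  unfolding join_def by simp

lemma subspaces_closed:
  assumes "is_qmatroid M" "a \<in> subspaces M" "b \<in> subspaces M"
  shows "join a b \<in> subspaces M" "a \<inter> b \<in> subspaces M"
proof -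
  have "vs.subspace (top_space M)"
    using assms(1) unfolding is_qmatroid_def by auto
  then show "join a b \<in> subspaces M" "a \<inter> b \<in> subspaces M"
    using assms(2,3) join_least[of "top_space M" a b] vs.subspace_inter
    unfolding subspaces_def by (auto simp: subspace_join)
qed

lemma finite_subspaces:
  fixes M :: "'k::{field,finite} qmatroid"
  assumes "is_qmatroid M"
  shows "finite (subspaces M)"
proof -
  obtain B where B: "finite B" "top_space M = vs.span B"
    using assms unfolding is_qmatroid_def by auto
  have "finite (vs.span B)"
    using B(1)
  proof (induction B)
    case empty
    then show ?case by simp
  next
    case (insert b B)
    have "vs.span (insert b B) \<subseteq> (\<lambda>(k, v). v + vscale k b) ` (UNIV \<times> vs.span B)"
    proof
      fix v assume "v \<in> vs.span (insert b B)"
      then obtain k where "v - vscale k b \<in> vs.span B"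
        unfolding vs.span_insert by blast
      then show "v \<in> (\<lambda>(k, v). v + vscale k b) ` (UNIV \<times> vs.span B)"
        by (intro image_eqI[of _ _ "(k, v - vscale k b)"]) simp_all
    qed
    then show ?case
      using finite_imageI[OF finite_cartesian_product[OF finite_class.finite_UNIV insert.IH]]
      by (rule finite_subset)
  qed
  then have "finite (Pow (top_space M))"
    using B(2) by simp
  moreover have "subspaces M \<subseteq> Pow (top_space M)"
    unfolding subspaces_def by auto
  ultimately show ?thesis
    by (rule rev_finite_subset)
qed

lemma complement_exists:
  assumes "vs.subspace a" "vs.subspace b" "a \<subseteq> b"
  shows "\<exists>c. vs.subspace c \<and> c \<subseteq> b \<and> a \<inter> c = zero_space \<and> join a c = b"
proof -
  obtain A where A: "A \<subseteq> a" "vs.independent A" "a \<subseteq> vs.span A"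
    by (rule vs.maximal_independent_subset[of a])
  obtain B where B: "A \<subseteq> B" "B \<subseteq> b" "vs.independent B" "b \<subseteq> vs.span B"
    using vs.maximal_independent_subset_extend[OF subset_trans[OF A(1) assms(3)] A(2)] .
  have sa: "vs.span A = a" and sb: "vs.span B = b"
    using A B assms by (simp_all add: vs.span_minimal subset_antisym)
  define c where "c = vs.span (B - A)"
  have "join a c = b"
  proof -
    have "join a c = vs.span (A \<union> (B - A))"
      unfolding join_def c_def sa[symmetric]
      by (simp only: vs.span_Un vs.span_span)
    also have "A \<union> (B - A) = B"
      using B(1) by auto
    finally show ?thesis
      using sb by simp
  qed
  moreover have "a \<inter> c = zero_space"
  proof -
    have "x = 0" if x: "x \<in> a" "x \<in> c" for x
    proof -
      have r: "vs.representation B x = vs.representation A x"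
        using vs.representation_extend[OF B(3), of x A] x B(1) sa by auto
      have r': "vs.representation B x = vs.representation (B - A) x"
        using vs.representation_extend[OF B(3), of x "B - A"] x unfolding c_def by auto
      have "vs.representation B x v = 0" for v
      proof (rule ccontr)
        assume n: "vs.representation B x v \<noteq> 0"
        then have "v \<in> A" "v \<in> B - A"
          using r r' vs.representation_ne_zero[of A x v] vs.representation_ne_zero[of "B - A" x v]
          by simp_all
        then show False by simp
      qed
      moreover have "x \<in> vs.span B"
        using x(1) assms(3) sb by auto
      ultimately show ?thesis
        using vs.sum_nonzero_representation_eq[OF B(3), of x] by simp
    qed
    moreover have "0 \<in> a" "0 \<in> c"
      using assms(1) vs.subspace_0 vs.span_zero unfolding c_def by auto
    ultimately show ?thesis by auto
  qed
  moreover have "c \<subseteq> b"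
    unfolding c_def sb[symmetric] by (rule vs.span_mono) auto
  moreover have "vs.subspace c"
    unfolding c_def by simp
  ultimately show ?thesis by blast
qed

lemma quotient_space:
  assumes "vs.subspace a" "vs.subspace b" "a \<subseteq> b"
  shows "vs.subspace (quotient_space b a)" "quotient_space b a \<subseteq> b"
    "a \<inter> quotient_space b a = zero_space" "join a (quotient_space b a) = b"
  using someI_ex[OF complement_exists[OF assms]] unfolding quotient_space_def by auto

lemma is_qmatroid_minor:
  fixes M :: "'k::{field,finite} qmatroid"
  assumes M: "is_qmatroid M" and a: "a \<in> subspaces M" and b: "b \<in> subspaces M" and "a \<subseteq> b"
  shows "is_qmatroid (minor M a b)"
proof -
  define c where "c = quotient_space b a"
  have sub: "vs.subspace a" "vs.subspace b"
    using a b unfolding subspaces_def by auto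
  note c = quotient_space[OF sub \<open>a \<subseteq> b\<close>, folded c_def]
  have cM: "c \<in> subspaces M"
    using c b unfolding subspaces_def by auto
  have r: "rank M x \<le> height x" if "x \<in> subspaces M" for x
    using M that unfolding is_qmatroid_def by auto
  have mono: "rank M x \<le> rank M y" if "x \<in> subspaces M" "y \<in> subspaces M" "x \<subseteq> y" for x y
    using M that unfolding is_qmatroid_def by auto
  have subm: "rank M (join x y) + rank M (x \<inter> y) \<le> rank M x + rank M y"
    if "x \<in> subspaces M" "y \<in> subspaces M" for x y
    using M that unfolding is_qmatroid_def by auto
  have sM: "z \<in> subspaces M" if "z \<in> subspaces (minor M a b)" for z
    using that cM unfolding subspaces_def minor_def c_def by auto
  have jM: "join a z \<in> subspaces M" if "z \<in> subspaces (minor M a b)" for z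
    using subspaces_closed(1)[OF M a sM[OF that]] .
  have ra: "rank M a \<le> rank M (join a z)" if "z \<in> subspaces (minor M a b)" for z
    by (rule mono[OF a jM[OF that] join_upper1])
  have fin: "\<exists>B. finite B \<and> c = vs.span B"
  proof -
    obtain S where S: "finite S" "top_space M = vs.span S"
      using M unfolding is_qmatroid_def by auto
    obtain B where B: "B \<subseteq> c" "vs.independent B" "c \<subseteq> vs.span B"
      by (rule vs.maximal_independent_subset[of c])
    have "B \<subseteq> vs.span S"
      using B(1) cM S(2) unfolding subspaces_def by auto
    then have "finite B"
      using vs.independent_span_bound[OF S(1) B(2)] by auto
    moreover have "c = vs.span B"
      using B c(1) by (simp add: vs.span_minimal subset_antisym)
    ultimately show ?thesis by auto
  qed
  have 1: "rank M (join a z) - rank M a \<le> height z" if z: "z \<in> subspaces (minor M a b)" for z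
    using subm[OF a sM[OF z]] r[OF sM[OF z]] by linarith
  have 2: "rank M (join a x) \<le> rank M (join a y)"
    if "x \<in> subspaces (minor M a b)" "y \<in> subspaces (minor M a b)" "x \<subseteq> y" for x y
  proof -
    have "join a x \<subseteq> join a y"
      unfolding join_def using that(3) by (intro vs.span_mono) auto
    then show ?thesis
      using mono jM that(1,2) by blast
  qed
  have 3: "rank M (join a (join x y)) - rank M a + (rank M (join a (x \<inter> y)) - rank M a)
      \<le> rank M (join a x) - rank M a + (rank M (join a y) - rank M a)"
    if x: "x \<in> subspaces (minor M a b)" and y: "y \<in> subspaces (minor M a b)" for x y
  proof -
    have s: "vs.subspace x" "vs.subspace y"
      using x y unfolding subspaces_def by auto
    have j: "join (join a x) (join a y) = join a (join x y)"
      proof (intro subset_antisym join_least subspace_join)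
      note 1 = join_upper1[of a "join x y"] join_upper2[of "join x y" a]
        join_upper1[of x y] join_upper2[of y x]
      show "a \<subseteq> join a (join x y)" "x \<subseteq> join a (join x y)" "y \<subseteq> join a (join x y)"
        "a \<subseteq> join a (join x y)" using 1 by auto
      note 2 = join_upper1[of "join a x" "join a y"] join_upper2[of "join a y" "join a x"]
        join_upper1[of a x] join_upper2[of x a] join_upper2[of y a]
      show "a \<subseteq> join (join a x) (join a y)" "x \<subseteq> join (join a x) (join a y)"
        "y \<subseteq> join (join a x) (join a y)" using 2 by auto
    qed
    have i: "join a (x \<inter> y) \<subseteq> join a x \<inter> join a y"
    proof (intro Int_greatest join_least subspace_join join_upper1)
      show "x \<inter> y \<subseteq> join a x" "x \<inter> y \<subseteq> join a y"
        using join_upper2[of x a] join_upper2[of y a] by auto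
    qed
    have xy: "x \<inter> y \<in> subspaces (minor M a b)"
      using x y vs.subspace_inter[of x y] unfolding subspaces_def by auto
    have "rank M (join a (x \<inter> y)) \<le> rank M (join a x \<inter> join a y)"
      by (rule mono[OF jM[OF xy] subspaces_closed(2)[OF M jM[OF x] jM[OF y]] i])
    moreover have "rank M a \<le> rank M (join a (join x y))"
      using mono[OF a subspaces_closed(1)[OF M jM[OF x] jM[OF y]]] join_upper1[of a "join x y"]
      unfolding j by simp
    ultimately show ?thesis
      using subm[OF jM[OF x] jM[OF y]] ra[OF x] ra[OF y] ra[OF xy] unfolding j by linarith
  qed
  show ?thesis
    unfolding is_qmatroid_def using fin 1 2 3
    by (auto simp: minor_def c_def diff_le_mono)
qed

lemma minor_interval_iso:
  fixes M :: "'k::{field,finite} qmatroid"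
  assumes M: "is_qmatroid M" and a: "a \<in> subspaces M" and b: "b \<in> subspaces M" and "a \<subseteq> b"
  shows "\<exists>\<phi>. bij_betw \<phi> (interval M a b) (subspaces (minor M a b)) \<and>
    (\<forall>x\<in>interval M a b. \<forall>y\<in>interval M a b. x \<subseteq> y \<longleftrightarrow> \<phi> x \<subseteq> \<phi> y) \<and>
    (\<forall>x\<in>interval M a b. rank (minor M a b) (\<phi> x) = rank M x - rank M a)"
proof -
  define c where "c = quotient_space b a"
  have sub: "vs.subspace a" "vs.subspace b"
    using a b unfolding subspaces_def by auto
  note c = quotient_space[OF sub \<open>a \<subseteq> b\<close>, folded c_def]
  have I: "interval M a b = {x. vs.subspace x \<and> a \<subseteq> x \<and> x \<subseteq> b}"
    using b unfolding interval_def subspaces_def by auto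
  have S: "subspaces (minor M a b) = {z. vs.subspace z \<and> z \<subseteq> c}"
    unfolding subspaces_def minor_def c_def by simp
  have 1: "join a (x \<inter> c) = x" if x: "vs.subspace x" "a \<subseteq> x" "x \<subseteq> b" for x
  proof
    show "join a (x \<inter> c) \<subseteq> x"
      using x by (intro join_least) auto
    show "x \<subseteq> join a (x \<inter> c)"
    proof
      fix v assume v: "v \<in> x"
      then have "v \<in> join a c" using x c(4) by auto
      then obtain u w where uw: "u \<in> a" "w \<in> c" "v = u + w"
        unfolding join_alt[OF sub(1) c(1)] by auto
      then have "w = v - u" by simp
      then have "w \<in> x" using vs.subspace_diff[OF x(1) v] uw(1) x(2) by auto
      then show "v \<in> join a (x \<inter> c)"
        unfolding join_alt[OF sub(1) vs.subspace_inter[OF x(1) c(1)]] using uw by auto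
    qed
  qed
  have 2: "join a z \<inter> c = z" if z: "vs.subspace z" "z \<subseteq> c" for z
  proof
    show "z \<subseteq> join a z \<inter> c"
      using z(2) join_upper2[of z a] by auto
    show "join a z \<inter> c \<subseteq> z"
    proof
      fix v assume v: "v \<in> join a z \<inter> c"
      then obtain u w where uw: "u \<in> a" "w \<in> z" "v = u + w"
        unfolding join_alt[OF sub(1) z(1)] by auto
      then have "u = v - w" by simp
      then have "u \<in> c" using vs.subspace_diff[OF c(1)] v uw(2) z(2) by auto
      then have "u = 0" using uw(1) c(3) by auto
      then show "v \<in> z" using uw by simp
    qed
  qed
  have "bij_betw (\<lambda>x. x \<inter> c) (interval M a b) (subspaces (minor M a b))"
  proof (rule bij_betwI[where g = "join a"])
    show "(\<lambda>x. x \<inter> c) \<in> interval M a b \<rightarrow> subspaces (minor M a b)"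
      unfolding I S using c(1) vs.subspace_inter by auto
    show "join a \<in> subspaces (minor M a b) \<rightarrow> interval M a b"
    proof
      fix z assume "z \<in> subspaces (minor M a b)"
      then have "z \<subseteq> b" using c(2) unfolding S by auto
      then show "join a z \<in> interval M a b"
        unfolding I using join_least[OF sub(2) \<open>a \<subseteq> b\<close>] join_upper1[of a z]
        by (auto simp: subspace_join)
    qed
  qed (use 1 2 in \<open>auto simp: I S\<close>)
  moreover have "x \<subseteq> y \<longleftrightarrow> x \<inter> c \<subseteq> y \<inter> c" if x: "x \<in> interval M a b" and y: "y \<in> interval M a b"
    for x y
  proof
    assume h: "x \<inter> c \<subseteq> y \<inter> c"
    have "join a (x \<inter> c) \<subseteq> join a (y \<inter> c)"
      unfolding join_def using h by (intro vs.span_mono) auto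
    then show "x \<subseteq> y" using 1[of x] 1[of y] x y unfolding I by auto
  qed auto
  moreover have "rank (minor M a b) (x \<inter> c) = rank M x - rank M a" if "x \<in> interval M a b" for x
    using 1[of x] that unfolding I minor_def by auto
  ultimately show ?thesis
    by (intro exI[of _ "\<lambda>x. x \<inter> c"] conjI ballI)
qed

end

theory Submission
  imports Defs
begin

text \<open>
  The axiom (\<open>q\<close>-P2) already fails. It asks for a product formula over \<open>[\<zero>, e]\<close> and
  \<open>[e, \<one>]\<close>, which suits a Boolean lattice: there \<open>z \<mapsto> (z \<and> e, z \<or> e)\<close> is a bijection
  from \<open>\<L>\<close> to \<open>[\<zero>, e] \<times> [e, \<one>]\<close>. In a subspace lattice of height at least \<open>2\<close> this map
  is not injective, because \<open>e\<close> has several complements, all sent to \<open>(\<zero>, \<one>)\<close>.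

  To see the failure on \<open>\<rho>\<close>, substitute \<open>x = y = 1\<close>. Every term of \<open>\<rho>(M; x, y)\<close> becomes \<open>1\<close>,
  so \<open>\<rho>(M; 1, 1) = |\<L>|\<close>. If \<open>M\<close> is prime-free, (\<open>q\<close>-P2) therefore gives
  \<open>|\<L>| = |[\<zero>, e]| \<cdot> |[e, \<one>]|\<close> for every atom \<open>e\<close>.

  A plane contradicts this. Both \<open>[\<zero>, e]\<close> and \<open>[e, \<one>]\<close> are chains with two elements, so the
  product is \<open>4\<close>, but a plane over \<open>\<bbbF>\<^sub>q\<close> has \<open>q + 3 \<ge> 5\<close> subspaces; the zero space, the plane,
  and the lines spanned by \<open>u\<close>, \<open>w\<close> and \<open>u + w\<close>, for a basis \<open>u\<close>, \<open>w\<close>, are five of them. The rank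
  function \<open>0\<close> makes the plane a \<open>q\<close>-matroid, and a prime-free one since the rank
  cannot increase inside a diamond.

  In \<open>\<int>[x, y]\<close> the two sides for this plane are \<open>1 + (q + 1) y + y\<^sup>2\<close> and \<open>(1 + y)\<^sup>2\<close>. Comparing their
  values at \<open>(1, 1)\<close> avoids computing either of them.
\<close>

text \<open>
  The terms of \<open>\<rho>\<close> are monomials with coefficient \<open>1\<close>. The inner evaluation substitutes for
  \<open>y\<close>, the outer one for \<open>x\<close>.
\<close>
lemma rank_generating_polynomial_at_1_1:
  "poly (poly (rank_generating_polynomial M) 1) 1 = int (card (subspaces M))"
  unfolding rank_generating_polynomial_def by (simp add: poly_sum poly_monom)

lemma card_subspaces_minor:
  fixes M :: "'k::{field,finite} qmatroid"
  assumes "is_qmatroid M" "a \<in> subspaces M" "b \<in> subspaces M" "a \<subseteq> b"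
  shows "card (subspaces (minor M a b)) = card (interval M a b)"
  using minor_interval_iso[OF assms] bij_betw_same_card by metis

text \<open>
  Adjoining one generator leaves no room for a subspace in between: by the exchange property, a
  vector of \<open>x\<close> outside \<open>span A\<close> generates \<open>b\<close> together with \<open>A\<close>.
\<close>
lemma subspace_between_span_insert:
  assumes x: "vs.subspace x" "vs.span A \<subseteq> x" "x \<subseteq> vs.span (insert b A)"
  shows "x = vs.span A \<or> x = vs.span (insert b A)"
proof (cases "x \<subseteq> vs.span A")
  case False
  then obtain v where v: "v \<in> x" "v \<notin> vs.span A" by blast
  have "b \<in> vs.span (insert v A)"
    using vs.in_span_insert[of v b A] v x(3) by blast
  moreover have A: "A \<subseteq> x" using x(2) vs.span_superset by blast
  then have "vs.span (insert v A) \<subseteq> x"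
    using v(1) x(1) by (simp add: vs.span_minimal)
  ultimately have "vs.span (insert b A) \<subseteq> x"
    using A x(1) by (intro vs.span_minimal) auto
  then show ?thesis using x(3) by blast
qed (use x(2) in blast)

lemma card_interval_span_insert:
  "card (interval M (vs.span A) (vs.span (insert b A))) \<le> 2"
proof -
  have "interval M (vs.span A) (vs.span (insert b A)) \<subseteq> {vs.span A, vs.span (insert b A)}"
    unfolding interval_def subspaces_def using subspace_between_span_insert by blast
  then have "card (interval M (vs.span A) (vs.span (insert b A)))
      \<le> card {vs.span A, vs.span (insert b A)}"
    by (intro card_mono) auto
  also have "\<dots> \<le> 2"
    by (simp add: card_insert_if)
  finally show ?thesis .
qed

text \<open>
  The condition in the definition of a prime diamond ranges over the elements strictly inside
  it, so refuting primeness needs one such element.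
\<close>
lemma diamond_has_inner_element:
  fixes M :: "'k::{field,finite} qmatroid"
  assumes M: "is_qmatroid M" and d: "diamond M a b"
  shows "\<exists>x\<in>subspaces M. a \<subset> x \<and> x \<subset> b"
proof -
  have a: "vs.subspace a" and b: "vs.subspace b" "b \<subseteq> top_space M"
    and ab: "a \<subseteq> b" "height b = height a + 2"
    using d unfolding diamond_def subspaces_def by auto
  obtain A where A: "A \<subseteq> a" "vs.independent A" "a \<subseteq> vs.span A" "card A = height a"
    using vs.basis_exists[of a] by blast
  obtain S where S: "finite S" "top_space M = vs.span S"
    using M unfolding is_qmatroid_def by blast
  have finA: "finite A"
    using vs.independent_span_bound[OF S(1) A(2)] A(1) ab(1) b(2) S(2) by blast
  have "a \<noteq> b" using ab(2) by auto
  then obtain v where v: "v \<in> b" "v \<notin> a" using ab(1) by blast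
  define x where "x = vs.span (insert v A)"
  have xb: "x \<subseteq> b"
    unfolding x_def using v(1) A(1) ab(1) b(1) by (intro vs.span_minimal) auto
  have "x \<noteq> b"
  proof
    assume "x = b"
    then have "height b \<le> card (insert v A)"
      unfolding x_def using finA by (intro vs.dim_le_card) auto
    also have "\<dots> \<le> height a + 1"
      using finA A(4) by (simp add: card_insert_if)
    finally show False using ab(2) by simp
  qed
  moreover have "a \<subseteq> x"
    unfolding x_def using A(3) vs.span_mono[of A "insert v A"] by blast
  moreover have "v \<in> x"
    unfolding x_def by (simp add: vs.span_base)
  ultimately have "a \<subset> x" "x \<subset> b" using xb v(2) by auto
  moreover have "x \<in> subspaces M"
    unfolding subspaces_def using xb b(2) by (auto simp: x_def)
  ultimately show ?thesis by blast
qed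

definition rank_zero_qmatroid :: "'k::field vect set \<Rightarrow> 'k qmatroid" where
  "rank_zero_qmatroid V = \<lparr>top_space = V, rank = (\<lambda>_. 0)\<rparr>"

lemma is_qmatroid_rank_zero:
  assumes "finite B"
  shows "is_qmatroid (rank_zero_qmatroid (vs.span B))"
proof -
  have "\<exists>B'. finite B' \<and> vs.span B = vs.span B'"
    using assms by blast
  then show ?thesis
    unfolding is_qmatroid_def rank_zero_qmatroid_def by simp
qed

lemma prime_free_rank_zero:
  fixes V :: "'k::{field,finite} vect set"
  assumes "is_qmatroid (rank_zero_qmatroid V)"
  shows "prime_free (rank_zero_qmatroid V)"
  unfolding prime_free_def
proof
  assume "\<exists>a b. prime_diamond (rank_zero_qmatroid V) a b"
  then obtain a b where p: "prime_diamond (rank_zero_qmatroid V) a b" by blast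
  then have "diamond (rank_zero_qmatroid V) a b"
    unfolding prime_diamond_def by blast
  from diamond_has_inner_element[OF assms this]
  obtain x where "x \<in> subspaces (rank_zero_qmatroid V)" "a \<subset> x" "x \<subset> b"
    by blast
  then have "rank (rank_zero_qmatroid V) x = rank (rank_zero_qmatroid V) a + 1"
    using p unfolding prime_diamond_def by blast
  then show False by (simp add: rank_zero_qmatroid_def)
qed

lemma five_subspaces_of_plane:
  fixes M :: "'k::{field,finite} qmatroid"
  assumes M: "is_qmatroid M" and top: "top_space M = vs.span {w, u}"
    and u: "u \<noteq> 0" and w: "w \<notin> vs.span {u}"
  shows "5 \<le> card (subspaces M)"
proof -
  let ?S = "{vs.span {}, vs.span {u}, vs.span {w}, vs.span {u + w}, vs.span {w, u}}"
  have w': "u \<notin> vs.span {w}"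
    using vs.in_span_insert[of u w "{}"] u w by auto
  have uw: "u + w \<notin> vs.span {u}" "u + w \<notin> vs.span {w}"
    using w w' vs.span_add_eq[of u "{u}" w] vs.span_add_eq2[of w "{w}" u]
    by (auto simp: vs.span_base)
  have nz: "w \<noteq> 0" "u + w \<noteq> 0"
    using w uw(1) vs.span_zero[of "{u}"] by auto
  have wu: "u \<notin> vs.span {u + w}" "w \<notin> vs.span {u + w}"
    using vs.in_span_insert[of u "u + w" "{}"] vs.in_span_insert[of w "u + w" "{}"] uw u nz
    by auto
  have b: "u \<in> vs.span {u}" "w \<in> vs.span {w}" "u + w \<in> vs.span {u + w}"
    by (simp_all add: vs.span_base)
  have t: "u \<in> vs.span {w, u}" "w \<in> vs.span {w, u}" "u + w \<in> vs.span {w, u}"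
    by (simp_all add: vs.span_base vs.span_add)
  have z: "u \<notin> vs.span {}" "w \<notin> vs.span {}" "u + w \<notin> vs.span {}"
    using u nz by simp_all
  \<comment> \<open>No two of the five contain the same ones among \<open>u\<close>, \<open>w\<close>, \<open>u + w\<close>.\<close>
  have "distinct [vs.span {}, vs.span {u}, vs.span {w}, vs.span {u + w}, vs.span {w, u}]"
    unfolding distinct.simps list.set using z b t w w' uw wu by blast
  from distinct_card[OF this] have "card ?S = 5"
    by simp
  moreover have "?S \<subseteq> subspaces M"
  proof -
    have "vs.span X \<in> subspaces M" if "X \<subseteq> vs.span {w, u}" for X
      unfolding subspaces_def top using that by (simp add: vs.span_minimal)
    then show ?thesis using t by (simp del: vs.span_empty)
  qed
  ultimately show ?thesis
    using card_mono[OF finite_subspaces[OF M], of ?S] by simp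
qed

theorem proposition81:
  shows "\<not> q_Tutte_Grothendieck_invariant
           (rank_generating_polynomial :: 'k::{field,finite} qmatroid \<Rightarrow> int poly poly)"
proof
  let ?\<rho> = "rank_generating_polynomial :: 'k qmatroid \<Rightarrow> int poly poly"
  assume inv: "q_Tutte_Grothendieck_invariant ?\<rho>"
  define u w :: "'k vect" where "u = (\<lambda>i. if i = 0 then 1 else 0)"
    and "w = (\<lambda>i. if i = 1 then 1 else 0)"
  have u: "u \<noteq> 0"
    by (auto simp: u_def fun_eq_iff)
  have w: "w \<notin> vs.span {u}"
  proof
    assume "w \<in> vs.span {u}"
    then obtain k where "w = vscale k u"
      unfolding vs.span_singleton by blast
    then have "w 1 = vscale k u 1" by simp
    then show False by (simp add: u_def w_def vscale_def)
  qed
  define M :: "'k qmatroid" where "M = rank_zero_qmatroid (vs.span {w, u})"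
  have top: "top_space M = vs.span {w, u}"
    by (simp add: M_def rank_zero_qmatroid_def)
  have M: "is_qmatroid M"
    unfolding M_def by (rule is_qmatroid_rank_zero) simp
  have "prime_free M"
    using M unfolding M_def by (rule prime_free_rank_zero)
  define e where "e = vs.span {u}"
  have e: "e \<in> subspaces M"
    unfolding subspaces_def top e_def by (simp add: vs.span_mono)
  have "height e = 1"
    unfolding e_def using u by (simp add: vs.dim_eq_card_independent)
  with e have "atom M e"
    unfolding atom_def by simp
  with inv M \<open>prime_free M\<close> have "?\<rho> M = ?\<rho> (restriction M e) * ?\<rho> (contraction M e)"
    unfolding q_Tutte_Grothendieck_invariant_def by blast
  then have "poly (poly (?\<rho> M) 1) 1
      = poly (poly (?\<rho> (restriction M e)) 1) 1 * poly (poly (?\<rho> (contraction M e)) 1) 1"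
    by simp
  then have card: "card (subspaces M)
      = card (subspaces (restriction M e)) * card (subspaces (contraction M e))"
    unfolding rank_generating_polynomial_at_1_1 by (simp flip: of_nat_mult)
  have "zero_space \<in> subspaces M" "top_space M \<in> subspaces M"
    unfolding subspaces_def top by (auto simp: vs.span_zero)
  moreover have "zero_space \<subseteq> e" "e \<subseteq> top_space M"
    using e unfolding subspaces_def by (auto simp: vs.subspace_0)
  ultimately have "card (subspaces (restriction M e)) \<le> 2" "card (subspaces (contraction M e)) \<le> 2"
    using card_interval_span_insert[of M "{}" u] card_interval_span_insert[of M "{u}" w] M e
    by (simp_all add: card_subspaces_minor e_def top)
  then have "card (subspaces M) \<le> 2 * 2"
    unfolding card by (rule mult_le_mono)
  with five_subspaces_of_plane[OF M top u w] show False by simp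
qed

end
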